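(* There exists a last-use opaque history that does not avoid cascading aborts; namely, some last-use opaque history contains transactions $T_i\neq T_j$ such that $T_j$ reads from $T_i$ via a read that occurs before $T_i$ commits.
   Context: Standard TM model: transactions with operations $\mathit{init}_i$, $\mathit{read}_i(x)$, $\mathit{write}_i(x,v)$, $\mathit{tryC}_i$, $\mathit{tryA}_i$; well-formed histories with unique writes; variables with domain $\mathbb{N}_0$, initial value $0$. $T_j$ reads from $T_i$ if $H|T_i$ contains $w_i(x,v)\to ok_i$ and $H|T_j$ contains $r_j(x)\to v$ for some $x,v$. A history avoids cascading aborts (ACA) iff for all $T_i\neq T_j$ such that $T_j$ reads from $T_i$, $T_i$ commits before that read. Committed/aborted/live, completion, equivalence, real-time order $\prec_H$, sequential histories as usual. Sequential $S'$ legal iff for each $x$, every read in $S'|x$ returning a value returns the latest preceding written value (or $0$). $\mathrm{vis}(S,T_i)$: subhistory of $S$ of $S|T_j$ for $j=i$ or $T_j$ committed with $T_j\prec_S T_i$; $T_i$ legal iff $\mathrm{vis}$ legal. Last-use opacity (relative to the program producing $H$): $T_j$ is decided on $x$ if $H|T_j$ contains a complete write on $x$ (response $\ne A_j$) after which no producible extension of $H$ has another write invocation by $T_j$ on $x$; $S\Downarrow_C T_j$: $T_j$'s $\mathit{init}_j$ and operations on its decided variables followed by $\mathit{tryC}_j\to C_j$. A last-use view of $T_i$ in sequential $S$ contains $S|T_j$ if $j=i$ or $T_j$ committed with $T_j\prec_S T_i$; if $T_j$ not committed, decided on some variable, $T_j\prec_S T_i$ and not $T_j\prec_H T_i$, contains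 either $S\Downarrow_C T_j$ or nothing; otherwise nothing. $T_i$ last-use legal iff some last-use view legal. Finite $H$ final-state last-use opaque iff some sequential $S$ equivalent to a completion of $H$ preserves $\prec_H$, committed transactions legal and others last-use legal; $H$ last-use opaque iff every finite prefix is final-state last-use opaque. *)

theory Defs
  imports Main "HOL-Library.Sublist"
begin

type_synonym tid = nat
type_synonym var = nat
type_synonym val = nat

datatype inv = Init | Rd var | Wr var val | TryC | TryA
datatype resp = InitOk | RVal val | WOk | Com | Ab
datatype event = Inv tid inv | Res tid resp

type_synonym history = "event list"

fun tid_of :: "event \<Rightarrow> tid" where
  "tid_of (Inv t _) = t"
| "tid_of (Res t _) = t"

definition sub :: "history \<Rightarrow> tid \<Rightarrow> history" where
  "sub H t = filter (\<lambda>e. tid_of e = t) H"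

fun matches :: "inv \<Rightarrow> resp \<Rightarrow> bool" where
  "matches Init r = (r = InitOk \<or> r = Ab)"
| "matches (Rd x) r = ((\<exists>v. r = RVal v) \<or> r = Ab)"
| "matches (Wr x v) r = (r = WOk \<or> r = Ab)"
| "matches TryC r = (r = Com \<or> r = Ab)"
| "matches TryA r = (r = Ab)"

fun terminal :: "resp \<Rightarrow> bool" where
  "terminal r = (r = Com \<or> r = Ab)"

text \<open>Well-formedness of a single transaction subhistory; the flag says whether
  init has already happened.\<close>
fun wf_seq :: "bool \<Rightarrow> history \<Rightarrow> bool" where
  "wf_seq b [] = True"
| "wf_seq b [Inv t i] = (b \<noteq> (i = Init))"
| "wf_seq b (Inv t i # Res t' r # rest) =
     (t = t' \<and> b \<noteq> (i = Init) \<and> matches i r \<and>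
      (if terminal r then rest = [] else wf_seq True rest))"
| "wf_seq b _ = False"

definition unique_writes :: "history \<Rightarrow> bool" where
  "unique_writes H = (\<forall>k k' t t' x v. k < k' \<longrightarrow> k' < length H \<longrightarrow>
      H ! k = Inv t (Wr x v) \<longrightarrow> H ! k' \<noteq> Inv t' (Wr x v))"

definition wf :: "history \<Rightarrow> bool" where
  "wf H = ((\<forall>t. wf_seq False (sub H t)) \<and> unique_writes H)"

definition cop :: "history \<Rightarrow> tid \<Rightarrow> nat \<Rightarrow> nat \<Rightarrow> inv \<Rightarrow> resp \<Rightarrow> bool" where
  "cop H t k k' i r = (k < k' \<and> k' < length H \<and> H ! k = Inv t i \<and> H ! k' = Res t r \<and>
      (\<forall>m. k < m \<longrightarrow> m < k' \<longrightarrow> tid_of (H ! m) \<noteq> t))"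

definition intx :: "tid \<Rightarrow> history \<Rightarrow> bool" where
  "intx t H = (\<exists>e\<in>set H. tid_of e = t)"

definition committed :: "tid \<Rightarrow> history \<Rightarrow> bool" where
  "committed t H = (Res t Com \<in> set H)"

definition aborted :: "tid \<Rightarrow> history \<Rightarrow> bool" where
  "aborted t H = (Res t Ab \<in> set H)"

definition live :: "tid \<Rightarrow> history \<Rightarrow> bool" where
  "live t H = (intx t H \<and> \<not> committed t H \<and> \<not> aborted t H)"

definition compl_ext :: "history \<Rightarrow> tid \<Rightarrow> history \<Rightarrow> bool" where
  "compl_ext H t xs =
     (if live t H then
        (case last (sub H t) of
           Inv _ TryC \<Rightarrow> xs = [Res t Com] \<or> xs = [Res t Ab]
         | Inv _ _ \<Rightarrow> xs = [Res t Ab]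
         | Res _ _ \<Rightarrow> xs = [Inv t TryA, Res t Ab])
      else xs = [])"

definition completion :: "history \<Rightarrow> history \<Rightarrow> bool" where
  "completion H Hc = (\<exists>ext. Hc = H @ ext \<and> (\<forall>t. compl_ext H t (sub ext t)))"

definition equiv_hist :: "history \<Rightarrow> history \<Rightarrow> bool" where
  "equiv_hist S H = (\<forall>t. sub S t = sub H t)"

definition prec :: "history \<Rightarrow> tid \<Rightarrow> tid \<Rightarrow> bool" where
  "prec H i j = ((committed i H \<or> aborted i H) \<and> intx j H \<and>
      (\<forall>a b. a < length H \<longrightarrow> b < length H \<longrightarrow> tid_of (H ! a) = i \<longrightarrow>
              tid_of (H ! b) = j \<longrightarrow> a < b))"

definition sequential :: "history \<Rightarrow> bool" where
  "sequential S = (\<forall>a b c. a < b \<longrightarrow> b < c \<longrightarrow> c < length S \<longrightarrow>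
      tid_of (S ! a) = tid_of (S ! c) \<longrightarrow> tid_of (S ! b) = tid_of (S ! a))"

definition wrote :: "history \<Rightarrow> var \<Rightarrow> nat \<Rightarrow> val \<Rightarrow> bool" where
  "wrote S x m w = (\<exists>t. m + 1 < length S \<and> S ! m = Inv t (Wr x w) \<and> S ! (m + 1) = Res t WOk)"

definition legal :: "history \<Rightarrow> bool" where
  "legal S = (\<forall>k t x v. 0 < k \<longrightarrow> k < length S \<longrightarrow> S ! (k - 1) = Inv t (Rd x) \<longrightarrow>
      S ! k = Res t (RVal v) \<longrightarrow>
      ((\<not> (\<exists>m w. m < k - 1 \<and> wrote S x m w)) \<and> v = 0) \<or>
      (\<exists>m. m < k - 1 \<and> wrote S x m v \<and> (\<forall>m' w'. m < m' \<longrightarrow> m' < k - 1 \<longrightarrow> \<not> wrote S x m' w')))"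

definition vis :: "history \<Rightarrow> tid \<Rightarrow> history" where
  "vis S i = filter (\<lambda>e. tid_of e = i \<or> (committed (tid_of e) S \<and> prec S (tid_of e) i)) S"

definition legal_tx :: "history \<Rightarrow> tid \<Rightarrow> bool" where
  "legal_tx S i = legal (vis S i)"

text \<open>A program is abstracted by the set P of histories it can produce (prefix closed,
  all well-formed). Producible extensions of H are the members of P having H as a prefix.\<close>
definition program :: "history set \<Rightarrow> bool" where
  "program P = ((\<forall>H\<in>P. wf H) \<and> (\<forall>H\<in>P. \<forall>n. take n H \<in> P))"

definition decided :: "history set \<Rightarrow> history \<Rightarrow> tid \<Rightarrow> var \<Rightarrow> bool" where
  "decided P H j x = (\<exists>k k' v r. cop H j k k' (Wr x v) r \<and> r \<noteq> Ab \<and>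
      (\<forall>H'\<in>P. prefix H H' \<longrightarrow> (\<forall>m v'. k' < m \<longrightarrow> m < length H' \<longrightarrow> H' ! m \<noteq> Inv j (Wr x v'))))"

fun keep_inv :: "(var \<Rightarrow> bool) \<Rightarrow> inv \<Rightarrow> bool" where
  "keep_inv d Init = True"
| "keep_inv d (Rd x) = d x"
| "keep_inv d (Wr x v) = d x"
| "keep_inv d TryC = False"
| "keep_inv d TryA = False"

text \<open>Whether position k of the sequential S belongs to S \<Down>_C T_j (init or an operation
  on a variable on which T_j is decided, in H); responses are attributed to the
  immediately preceding invocation.\<close>
definition keepD :: "history set \<Rightarrow> history \<Rightarrow> history \<Rightarrow> nat \<Rightarrow> bool" where
  "keepD P H S k = (case S ! k of
       Inv j i \<Rightarrow> keep_inv (decided P H j) i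
     | Res j _ \<Rightarrow> 0 < k \<and> (case S ! (k - 1) of Inv j' i \<Rightarrow> j' = j \<and> keep_inv (decided P H j) i
                                          | Res _ _ \<Rightarrow> False))"

definition last_of :: "history \<Rightarrow> nat \<Rightarrow> bool" where
  "last_of S k = (\<forall>k'. k < k' \<longrightarrow> k' < length S \<longrightarrow> tid_of (S ! k') \<noteq> tid_of (S ! k))"

text \<open>Candidates T_j whose S \<Down>_C T_j may be included in a last-use view of T_i.\<close>
definition lu_cand :: "history set \<Rightarrow> history \<Rightarrow> history \<Rightarrow> tid \<Rightarrow> tid \<Rightarrow> bool" where
  "lu_cand P H S i j = (j \<noteq> i \<and> \<not> committed j S \<and> (\<exists>x. decided P H j x) \<and>
      prec S j i \<and> \<not> prec H j i)"

text \<open>The last-use view of T_i in S including S \<Down>_C T_j exactly for j in D.\<close>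
definition luview :: "history set \<Rightarrow> history \<Rightarrow> history \<Rightarrow> tid \<Rightarrow> tid set \<Rightarrow> history" where
  "luview P H S i D = concat (map (\<lambda>k. let e = S ! k; t = tid_of e in
       (if t = i \<or> (committed t S \<and> prec S t i) \<or> (t \<in> D \<and> keepD P H S k) then [e] else [])
       @ (if t \<in> D \<and> last_of S k then [Inv t TryC, Res t Com] else []))
     [0..<length S])"

definition lu_legal :: "history set \<Rightarrow> history \<Rightarrow> history \<Rightarrow> tid \<Rightarrow> bool" where
  "lu_legal P H S i = (\<exists>D. D \<subseteq> {j. lu_cand P H S i j} \<and> legal (luview P H S i D))"

definition fs_lu_opaque :: "history set \<Rightarrow> history \<Rightarrow> bool" where
  "fs_lu_opaque P H = (\<exists>Hc S. completion H Hc \<and> sequential S \<and> equiv_hist S Hc \<and>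
      (\<forall>i j. prec H i j \<longrightarrow> prec S i j) \<and>
      (\<forall>i. committed i S \<longrightarrow> legal_tx S i) \<and>
      (\<forall>i. intx i S \<and> \<not> committed i S \<longrightarrow> lu_legal P H S i))"

definition lu_opaque :: "history set \<Rightarrow> history \<Rightarrow> bool" where
  "lu_opaque P H = (\<forall>n \<le> length H. fs_lu_opaque P (take n H))"

definition reads_from_at :: "history \<Rightarrow> tid \<Rightarrow> tid \<Rightarrow> nat \<Rightarrow> nat \<Rightarrow> bool" where
  "reads_from_at H i j k k' = (\<exists>x v a a'. cop H i a a' (Wr x v) WOk \<and> cop H j k k' (Rd x) (RVal v))"

definition ACA :: "history \<Rightarrow> bool" where
  "ACA H = (\<forall>i j k k'. i \<noteq> j \<longrightarrow> reads_from_at H i j k k' \<longrightarrow>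
      (\<exists>c. c < k \<and> H ! c = Res i Com))"

end

theory Submission
  imports Defs
begin

text \<open>The witness is a dirty read: T1 writes 1 to x and T2 reads this 1 before T1 commits
  (neither ever commits). Serialise T1 before T2 and abort both. The program can produce nothing
  beyond this history, so T1 is decided on x, and the last-use view of T2 may therefore contain T1
  as if committed, which justifies the read. Proper prefixes contain no read value at all, so
  every view of them is trivially legal.\<close>

lemma sub_append: "sub (A @ B) t = sub A t @ sub B t"
  by (simp add: sub_def)

lemma sub_sub: "sub (sub H a) t = (if t = a then sub H a else [])"
  by (auto simp: sub_def filter_empty_conv)

lemma wf_seq_prefix: "wf_seq b xs \<Longrightarrow> prefix ys xs \<Longrightarrow> wf_seq b ys"
proof (induction b xs arbitrary: ys rule: wf_seq.induct)
  case (2 b t i)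
  then show ?case by (cases ys) auto
next
  case (3 b t i t' r rest)
  then show ?case
    by (cases ys; cases "tl ys") (auto simp del: terminal.simps split: if_splits)
qed (auto simp: prefix_Cons)

lemma wf_take: "wf H \<Longrightarrow> wf (take n H)"
  unfolding wf_def sub_def unique_writes_def
  by (auto intro: wf_seq_prefix filter_mono_prefix take_is_prefix)

lemma program_prefixes: "wf H \<Longrightarrow> program (range (\<lambda>n. take n H))"
  unfolding program_def by (auto simp: wf_take min_def)

lemma prefixes_maximal: "H' \<in> range (\<lambda>n. take n H) \<Longrightarrow> prefix H H' \<Longrightarrow> H' = H"
  by (auto dest: prefix_length_le)

lemma decided_if_last_write:
  assumes "cop H j k k' (Wr x v) r" "r \<noteq> Ab"
    and "\<And>H'. H' \<in> P \<Longrightarrow> prefix H H' \<Longrightarrow> H' = H"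
    and "\<And>m v'. k' < m \<Longrightarrow> m < length H \<Longrightarrow> H ! m \<noteq> Inv j (Wr x v')"
  shows "decided P H j x"
  unfolding decided_def using assms by blast

lemma legal_if_no_read_values: "(\<And>t v. Res t (RVal v) \<notin> set S) \<Longrightarrow> legal S"
  unfolding legal_def by (metis nth_mem)

lemma last_of_iff: "last_of S k \<longleftrightarrow> (\<forall>e\<in>set (drop (Suc k) S). tid_of e \<noteq> tid_of (S ! k))"
proof -
  have "(\<forall>e\<in>set (drop (Suc k) S). tid_of e \<noteq> tid_of (S ! k)) \<longleftrightarrow>
      (\<forall>j < length S - Suc k. tid_of (S ! (Suc k + j)) \<noteq> tid_of (S ! k))"
    by (simp add: all_set_conv_all_nth)
  also have "\<dots> \<longleftrightarrow> last_of S k"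
    unfolding last_of_def
    by (rule iffI; simp) (metis less_iff_Suc_add add_Suc less_diff_conv add.commute)
  finally show ?thesis ..
qed

lemma set_luview_empty:
  "set (luview P H S i {}) \<subseteq> {e \<in> set S. tid_of e = i \<or> committed (tid_of e) S}"
  unfolding luview_def by (auto simp: Let_def split: if_splits)

lemma lu_legal_if_no_visible_read_values:
  assumes "\<And>t v. Res t (RVal v) \<in> set S \<Longrightarrow> t \<noteq> i \<and> \<not> committed t S"
  shows "lu_legal P H S i"
  unfolding lu_legal_def using set_luview_empty[of P H S i] assms
  by (intro exI[of _ "{}"]) (fastforce intro!: legal_if_no_read_values)

lemma sequential_append:
  assumes "\<forall>e\<in>set A. tid_of e = a" "\<forall>e\<in>set B. tid_of e = b" "a \<noteq> b"
  shows "sequential (A @ B)"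
  unfolding sequential_def
proof (intro allI impI)
  fix x y z
  assume xyz: "x < y" "y < z" "z < length (A @ B)" "tid_of ((A @ B) ! x) = tid_of ((A @ B) ! z)"
  have tid_A: "tid_of ((A @ B) ! k) = a" if "k < length A" for k
    using assms(1) that by (simp add: nth_append)
  have tid_B: "tid_of ((A @ B) ! k) = b" if "length A \<le> k" "k < length (A @ B)" for k
    using assms(2) that by (simp add: nth_append)
  show "tid_of ((A @ B) ! y) = tid_of ((A @ B) ! x)"
  proof (cases "z < length A")
    case True
    then show ?thesis using xyz tid_A by simp
  next
    case False
    then have "\<not> x < length A" using xyz tid_A tid_B assms(3) by force
    then show ?thesis using xyz tid_B by simp
  qed
qed

lemma prec_append:
  assumes "\<forall>e\<in>set A. tid_of e = a" "\<forall>e\<in>set B. tid_of e \<noteq> a"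
    and "aborted a A" "intx b B"
  shows "prec (A @ B) a b"
  unfolding prec_def
proof (intro conjI allI impI)
  show "committed a (A @ B) \<or> aborted a (A @ B)" using assms(3) by (simp add: aborted_def)
  show "intx b (A @ B)" using assms(4) by (auto simp: intx_def)
  fix p q
  assume "p < length (A @ B)" "q < length (A @ B)"
    and "tid_of ((A @ B) ! p) = a" "tid_of ((A @ B) ! q) = b"
  moreover have "b \<noteq> a" using assms(2,4) by (auto simp: intx_def)
  ultimately have "p < length A" "length A \<le> q"
    using assms(1,2) by (auto simp: nth_append split: if_splits)
  then show "p < q" by simp
qed

definition abort_ext :: "history \<Rightarrow> tid \<Rightarrow> history" where
  "abort_ext H t =
     (if live t H then
        (case last (sub H t) of Inv _ _ \<Rightarrow> [Res t Ab] | Res _ _ \<Rightarrow> [Inv t TryA, Res t Ab])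
      else [])"

lemma compl_ext_abort_ext: "compl_ext H t (abort_ext H t)"
  by (auto simp: compl_ext_def abort_ext_def split: event.split inv.split)

lemma sub_abort_ext: "sub (abort_ext H t) s = (if s = t then abort_ext H t else [])"
  by (auto simp: sub_def abort_ext_def split: event.split)

lemma set_abort_ext: "set (abort_ext H t) \<subseteq> {Inv t TryA, Res t Ab}"
  by (auto simp: abort_ext_def split: event.split)

lemma aborted_abort_ext: "live t H \<Longrightarrow> aborted t (abort_ext H t)"
  by (auto simp: abort_ext_def aborted_def split: event.split)

lemma completion_abort_two:
  assumes "a \<noteq> b" "\<forall>e\<in>set H. tid_of e \<in> {a, b}"
  shows "completion H (H @ abort_ext H a @ abort_ext H b)"
  unfolding completion_def
proof (intro exI conjI allI)
  fix t
  have "\<not> live t H" if "t \<noteq> a" "t \<noteq> b"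
    using assms(2) that by (auto simp: live_def intx_def)
  then have "abort_ext H t = []" if "t \<noteq> a" "t \<noteq> b"
    using that by (simp add: abort_ext_def)
  then show "compl_ext H t (sub (abort_ext H a @ abort_ext H b) t)"
    using compl_ext_abort_ext[of H t] assms(1)
    by (auto simp: sub_append sub_abort_ext)
qed simp

definition serial_abort :: "history \<Rightarrow> tid \<Rightarrow> tid \<Rightarrow> history" where
  "serial_abort H a b = sub H a @ abort_ext H a @ sub H b @ abort_ext H b"

lemma serial_abort_blocks:
  "serial_abort H a b = (sub H a @ abort_ext H a) @ (sub H b @ abort_ext H b)"
  by (simp add: serial_abort_def)

lemma set_serial_abort:
  "set (serial_abort H a b) \<subseteq> set H \<union> set (abort_ext H a) \<union> set (abort_ext H b)"
  by (auto simp: serial_abort_def sub_def)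

lemma prec_serial_abort:
  assumes "a \<noteq> b" "live a H" "intx b H"
  shows "prec (serial_abort H a b) a b"
  unfolding serial_abort_blocks
proof (rule prec_append)
  show "aborted a (sub H a @ abort_ext H a)"
    using aborted_abort_ext[OF assms(2)] by (simp add: aborted_def)
  show "intx b (sub H b @ abort_ext H b)"
    using assms(3) by (auto simp: intx_def sub_def)
qed (use assms(1) set_abort_ext in \<open>fastforce simp: sub_def\<close>)+

lemma fs_lu_opaque_serial_abort:
  assumes "a \<noteq> b" and tids: "\<forall>e\<in>set H. tid_of e \<in> {a, b}"
    and unfinished: "\<forall>t. Res t Com \<notin> set H \<and> Res t Ab \<notin> set H"
    and views_legal: "\<And>i. intx i (serial_abort H a b) \<Longrightarrow> lu_legal P H (serial_abort H a b) i"
  shows "fs_lu_opaque P H"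
  unfolding fs_lu_opaque_def
proof (intro exI conjI)
  let ?S = "serial_abort H a b"
  show "completion H (H @ abort_ext H a @ abort_ext H b)"
    using assms(1) tids by (rule completion_abort_two)
  show "sequential ?S"
    unfolding serial_abort_blocks
    by (rule sequential_append[of _ a _ b]) (use set_abort_ext assms(1) in \<open>fastforce simp: sub_def\<close>)+
  have "sub H t = []" if "t \<noteq> a" "t \<noteq> b" for t
    using tids that by (auto simp: sub_def filter_empty_conv)
  then show "equiv_hist ?S (H @ abort_ext H a @ abort_ext H b)"
    using assms(1) by (auto simp: equiv_hist_def serial_abort_def sub_append sub_sub sub_abort_ext)
  have no_commit: "\<not> committed i ?S" for i
    using unfinished set_abort_ext by (fastforce simp: committed_def serial_abort_def sub_def)
  show "\<forall>i j. prec H i j \<longrightarrow> prec ?S i j"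
    using unfinished by (simp add: prec_def committed_def aborted_def)
  show "\<forall>i. committed i ?S \<longrightarrow> legal_tx ?S i"
    using no_commit by simp
  show "\<forall>i. intx i ?S \<and> \<not> committed i ?S \<longrightarrow> lu_legal P H ?S i"
    using views_legal by simp
qed

definition dirty_read :: history where
  "dirty_read = [Inv 1 Init, Res 1 InitOk, Inv 1 (Wr 0 1), Res 1 WOk,
                 Inv 2 Init, Res 2 InitOk, Inv 2 (Rd 0), Res 2 (RVal 1)]"

lemma wf_dirty_read: "wf dirty_read"
  unfolding wf_def
proof (intro conjI allI)
  show "wf_seq False (sub dirty_read t)" for t
    by (cases "t = 1"; cases "t = 2") (auto simp: sub_def dirty_read_def)
  show "unique_writes dirty_read"
    unfolding unique_writes_def
  proof (intro allI impI)
    fix k k' t t' x v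
    assume "k < k'" "k' < length dirty_read" "dirty_read ! k = Inv t (Wr x v)"
    then have "k = 2" "k' < 8" by (auto simp: dirty_read_def nth_Cons' split: if_splits)
    with \<open>k < k'\<close> show "dirty_read ! k' \<noteq> Inv t' (Wr x v)"
      by (auto simp: dirty_read_def nth_Cons' split: if_splits)
  qed
qed

lemma not_ACA_dirty_read: "\<not> ACA dirty_read"
proof
  assume aca: "ACA dirty_read"
  have reads: "reads_from_at dirty_read 1 2 6 7"
    unfolding reads_from_at_def cop_def
    by (intro exI[of _ 0] exI[of _ 1] exI[of _ 2] exI[of _ 3]) (simp add: dirty_read_def)
  obtain c where "c < 6" "dirty_read ! c = Res 1 Com"
    using aca[unfolded ACA_def, rule_format, OF _ reads] by auto
  then show False by (auto simp: dirty_read_def nth_Cons' split: if_splits)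
qed

definition dirty_read_program :: "history set" where
  "dirty_read_program = range (\<lambda>n. take n dirty_read)"

lemma serial_abort_dirty_read: "serial_abort dirty_read 1 2 =
   [Inv 1 Init, Res 1 InitOk, Inv 1 (Wr 0 1), Res 1 WOk, Inv 1 TryA, Res 1 Ab,
    Inv 2 Init, Res 2 InitOk, Inv 2 (Rd 0), Res 2 (RVal 1), Inv 2 TryA, Res 2 Ab]"
  by (simp add: serial_abort_def abort_ext_def sub_def dirty_read_def live_def intx_def
      committed_def aborted_def)

lemma decided_dirty_read: "decided dirty_read_program dirty_read 1 0"
proof (rule decided_if_last_write)
  show "cop dirty_read 1 2 3 (Wr 0 1) WOk" by (simp add: cop_def dirty_read_def)
  show "\<And>H'. H' \<in> dirty_read_program \<Longrightarrow> prefix dirty_read H' \<Longrightarrow> H' = dirty_read"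
    unfolding dirty_read_program_def by (rule prefixes_maximal)
  show "\<And>m v'. 3 < m \<Longrightarrow> m < length dirty_read \<Longrightarrow> dirty_read ! m \<noteq> Inv 1 (Wr 0 v')"
    by (auto simp: dirty_read_def nth_Cons' less_Suc_eq numeral_eq_Suc)
qed simp

lemma luview_dirty_read: "luview dirty_read_program dirty_read (serial_abort dirty_read 1 2) 2 {1} =
   [Inv 1 Init, Res 1 InitOk, Inv 1 (Wr 0 1), Res 1 WOk, Inv 1 TryC, Res 1 Com,
    Inv 2 Init, Res 2 InitOk, Inv 2 (Rd 0), Res 2 (RVal 1), Inv 2 TryA, Res 2 Ab]"
  unfolding serial_abort_dirty_read luview_def
  by (simp add: upt_rec Let_def committed_def last_of_iff keepD_def
      decided_dirty_read[unfolded One_nat_def])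

lemma legal_committed_write_read: "legal
   [Inv 1 Init, Res 1 InitOk, Inv 1 (Wr 0 1), Res 1 WOk, Inv 1 TryC, Res 1 Com,
    Inv 2 Init, Res 2 InitOk, Inv 2 (Rd 0), Res 2 (RVal 1), Inv 2 TryA, Res 2 Ab]"
  (is "legal ?V")
  unfolding legal_def
proof (intro allI impI)
  fix k t x v
  assume read: "0 < k" "k < length ?V" "?V ! (k - 1) = Inv t (Rd x)" "?V ! k = Res t (RVal v)"
  then have "k = 9" "x = 0" "v = 1"
    by (auto simp: nth_Cons' split: if_splits)
  moreover have "\<not> wrote ?V 0 m w" if "2 < m" "m < 8" for m w
    using that by (auto simp: wrote_def nth_Cons' split: if_splits)
  ultimately show "(\<not> (\<exists>m w. m < k - 1 \<and> wrote ?V x m w) \<and> v = 0) \<or>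
      (\<exists>m. m < k - 1 \<and> wrote ?V x m v \<and> (\<forall>m' w'. m < m' \<longrightarrow> m' < k - 1 \<longrightarrow> \<not> wrote ?V x m' w'))"
    by (intro disjI2 exI[of _ 2]) (simp add: wrote_def)
qed

lemma lu_legal_dirty_read:
  assumes "intx i (serial_abort dirty_read 1 2)"
  shows "lu_legal dirty_read_program dirty_read (serial_abort dirty_read 1 2) i"
proof -
  let ?S = "serial_abort dirty_read 1 2"
  have no_commit: "\<not> committed t ?S" for t
    unfolding serial_abort_dirty_read committed_def by simp
  have "i = 1 \<or> i = 2"
    using assms unfolding serial_abort_dirty_read intx_def by auto
  then show ?thesis
  proof
    assume "i = 1"
    show ?thesis
    proof (rule lu_legal_if_no_visible_read_values)
      fix t v
      assume "Res t (RVal v) \<in> set ?S"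
      then have "t = 2" unfolding serial_abort_dirty_read by auto
      with \<open>i = 1\<close> no_commit show "t \<noteq> i \<and> \<not> committed t ?S" by simp
    qed
  next
    assume i: "i = 2"
    have "lu_cand dirty_read_program dirty_read ?S 2 1"
      unfolding lu_cand_def
    proof (intro conjI exI)
      show "prec ?S 1 2"
        by (rule prec_serial_abort) (auto simp: dirty_read_def live_def intx_def committed_def aborted_def)
      show "\<not> prec dirty_read 1 2"
        by (simp add: prec_def committed_def aborted_def dirty_read_def)
    qed (use no_commit decided_dirty_read in auto)
    moreover have "legal (luview dirty_read_program dirty_read ?S 2 {1})"
      unfolding luview_dirty_read by (rule legal_committed_write_read)
    ultimately show ?thesis
      unfolding lu_legal_def i by blast
  qed
qed

lemma fs_lu_opaque_dirty_read_prefix: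
  assumes "n \<le> length dirty_read"
  shows "fs_lu_opaque dirty_read_program (take n dirty_read)"
proof (rule fs_lu_opaque_serial_abort[of 1 2])
  have events: "set (take n dirty_read) \<subseteq> set dirty_read" by (rule set_take_subset)
  then show "\<forall>e\<in>set (take n dirty_read). tid_of e \<in> {1, 2}"
    by (auto simp: dirty_read_def)
  from events show "\<forall>t. Res t Com \<notin> set (take n dirty_read) \<and> Res t Ab \<notin> set (take n dirty_read)"
    by (auto simp: dirty_read_def)
  fix i
  assume active: "intx i (serial_abort (take n dirty_read) 1 2)"
  show "lu_legal dirty_read_program (take n dirty_read) (serial_abort (take n dirty_read) 1 2) i"
  proof (cases "n < length dirty_read")
    case True
    then have "set (take n dirty_read) \<subseteq> set (take 7 dirty_read)"
      by (intro set_take_subset_set_take) (simp add: dirty_read_def)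
    moreover have "Res t (RVal v) \<notin> set (take 7 dirty_read)" for t v
      by (simp add: dirty_read_def)
    moreover have "Res t (RVal v) \<notin> set (abort_ext H s)" for t v H s
      using set_abort_ext by blast
    ultimately have "Res t (RVal v) \<notin> set (serial_abort (take n dirty_read) 1 2)" for t v
      using set_serial_abort by blast
    then show ?thesis by (intro lu_legal_if_no_visible_read_values) auto
  next
    case False
    then have "take n dirty_read = dirty_read" using assms by simp
    then show ?thesis using lu_legal_dirty_read active by simp
  qed
qed simp

theorem mainTheorem16:
  shows "\<exists>P H. program P \<and> H \<in> P \<and> wf H \<and> lu_opaque P H \<and> \<not> ACA H"
proof (intro exI conjI)
  show "program dirty_read_program"
    unfolding dirty_read_program_def using wf_dirty_read by (rule program_prefixes)
  show "dirty_read \<in> dirty_read_program"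
    unfolding dirty_read_program_def by (rule range_eqI[of _ _ "length dirty_read"]) simp
  show "wf dirty_read" by (rule wf_dirty_read)
  show "lu_opaque dirty_read_program dirty_read"
    unfolding lu_opaque_def using fs_lu_opaque_dirty_read_prefix by blast
  show "\<not> ACA dirty_read" by (rule not_ACA_dirty_read)
qed

end
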